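(* Let $\mathbb{F}$ be a field and let $V$ be a vector space over $\mathbb{F}$ with countable dimension. Then every locally nilpotent endomorphism of $V$ is the sum of two square-zero endomorphisms of $V$.
   Context: "Countable" includes finite. An endomorphism $u$ of $V$ is locally nilpotent if for every $x\in V$ there is $n\in\mathbb{N}$ with $u^n(x)=0$. An endomorphism $a$ is square-zero if $a^2=0$. *)

theory Defs
  imports Complex_Main "HOL-Library.Countable_Set"
begin

text \<open>
  As in the library's locale \<open>vector_space\<close>, the space \<open>V\<close> is a whole type \<open>'b\<close> with scalar
  multiplication \<open>scale\<close> over the field \<open>'a\<close>. The library's \<open>dim\<close> is a natural number and is
  \<open>0\<close> on infinite-dimensional spaces, so countable dimension is stated through a basis.
\<close>

abbreviation endomorphism :: "('a::field \<Rightarrow> 'b::ab_group_add \<Rightarrow> 'b) \<Rightarrow> ('b \<Rightarrow> 'b) \<Rightarrow> bool" where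
  "endomorphism scale u \<equiv> Vector_Spaces.linear scale scale u"

definition countable_dimension :: "('a::field \<Rightarrow> 'b::ab_group_add \<Rightarrow> 'b) \<Rightarrow> bool" where
  "countable_dimension scale \<longleftrightarrow>
     (\<exists>B. countable B \<and> \<not> module.dependent scale B \<and> module.span scale B = UNIV)"

definition locally_nilpotent :: "('b::zero \<Rightarrow> 'b) \<Rightarrow> bool" where
  "locally_nilpotent u \<longleftrightarrow> (\<forall>x. \<exists>n::nat. (u ^^ n) x = 0)"

definition square_zero :: "('b::zero \<Rightarrow> 'b) \<Rightarrow> bool" where
  "square_zero a \<longleftrightarrow> a \<circ> a = (\<lambda>x. 0)"

end

theory Submission
  imports Defs "HOL-Library.Set_Algebras"
begin

text \<open>
  It suffices to find a decomposition \<open>V = A \<oplus> B\<close> with \<open>u A \<subseteq> B\<close> and \<open>u B \<subseteq> A\<close>: then \<open>u\<close> is the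
  sum of its compositions with the two projections, and both have square zero. The decomposition is
  the union of a countable chain of pairs \<open>(A, B)\<close> of finite-dimensional subspaces, each step
  absorbing one more basis vector. As in the Kaplansky-Mackey proof of Ulm's theorem, the
  steps can only be continued if the pairs respect transfinite heights: with
  \<open>V\<^sub>0 = V\<close>, \<open>V\<^sub>\<alpha>\<^sub>+\<^sub>1 = u V\<^sub>\<alpha>\<close> and intersections at limits, every \<open>V\<^sub>\<alpha> \<inter> (A + B)\<close>
  has to be the sum of \<open>V\<^sub>\<alpha> \<inter> A\<close> and \<open>V\<^sub>\<alpha> \<inter> B\<close>.
\<close>

section \<open>Linearity of \<open>u\<close> and sums of subspaces\<close>

locale endo = vector_space scale
  for scale :: "'a::field \<Rightarrow> 'b::ab_group_add \<Rightarrow> 'b" +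
  fixes u :: "'b \<Rightarrow> 'b"
  assumes linear_u: "Vector_Spaces.linear scale scale u"
begin

lemma u_add: "u (x + y) = u x + u y"
  and u_scale: "u (scale c x) = scale c (u x)"
  using linear_u
  by (auto simp: Vector_Spaces.linear_def module_hom_def module_hom_axioms_def)

lemma u_0: "u 0 = 0"
  using u_add[of 0 0] by simp

lemma u_neg: "u (- x) = - u x"
  using u_add[of x "- x"] u_0 by (simp add: eq_neg_iff_add_eq_0 add.commute)

lemma u_diff: "u (x - y) = u x - u y"
  using u_add[of x "- y"] u_neg by simp

lemma subspace_image: "subspace W \<Longrightarrow> subspace (u ` W)"
  unfolding subspace_def by (auto simp flip: u_add u_scale intro: image_eqI[of _ _ 0] simp: u_0)

lemma subspace_set_plus: "subspace A \<Longrightarrow> subspace B \<Longrightarrow> subspace (A + B)"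
proof -
  have "A + B = {x + y |x y. x \<in> A \<and> y \<in> B}" by (auto simp: set_plus_def)
  then show "subspace A \<Longrightarrow> subspace B \<Longrightarrow> subspace (A + B)" using subspace_sums by simp
qed

lemma set_plus_left: "subspace B \<Longrightarrow> x \<in> A \<Longrightarrow> x \<in> A + B"
  using set_plus_intro[of x A 0 B] by (simp add: subspace_0)

lemma set_plus_right: "subspace A \<Longrightarrow> x \<in> B \<Longrightarrow> x \<in> A + B"
  using set_plus_intro[of 0 A x B] by (simp add: subspace_0)

definition line :: "'b \<Rightarrow> 'b set" where
  "line x = range (\<lambda>c. scale c x)"

lemma subspace_line: "subspace (line x)"
  unfolding line_def subspace_def
  by (auto simp flip: scale_left_distrib intro: image_eqI[of _ _ 0])

lemma self_in_line: "x \<in> line x"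
  unfolding line_def by (auto intro: image_eqI[of _ _ 1])

lemma set_plus_lineE:
  assumes "y \<in> S + line x"
  obtains s c where "s \<in> S" "y = s + scale c x"
  using assms by (auto simp: line_def elim!: set_plus_elim)

lemma scale_mem_cancel:
  assumes "subspace W" "c \<noteq> 0" "scale c x \<in> W"
  shows "x \<in> W"
  using subspace_scale[OF assms(1,3), of "inverse c"] assms(2) by simp

section \<open>The tower of transfinitely iterated images\<close>

text \<open>
  The tower consists of the subspaces \<open>V\<^sub>\<alpha>\<close>, without reference to ordinals; a vector has height at
  least that of \<open>x\<close> iff it lies in the least member containing \<open>x\<close>.
\<close>

inductive_set tower :: "'b set set" where
  tower_image: "W \<in> tower \<Longrightarrow> u ` W \<in> tower"
| tower_Inter: "\<forall>W\<in>\<A>. W \<in> tower \<Longrightarrow> \<Inter>\<A> \<in> tower"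

lemma tower_UNIV: "UNIV \<in> tower"
  using tower_Inter[of "{}"] by simp

lemma tower_subspace: "W \<in> tower \<Longrightarrow> subspace W"
proof (induction rule: tower.induct)
  case (tower_Inter \<A>)
  then show ?case by (auto simp: subspace_def)
qed (rule subspace_image)

lemma tower_image_subset: "W \<in> tower \<Longrightarrow> u ` W \<subseteq> W"
proof (induction rule: tower.induct)
  case (tower_Inter \<A>)
  then show ?case by blast
qed (rule image_mono)

lemma tower_successor:
  assumes "Q \<in> tower" "W \<in> tower"
  shows "Q \<subseteq> W \<or> W \<subseteq> u ` Q"
proof -
  \<comment> \<open>First induction, on \<open>W\<close>, for those \<open>Q\<close> that remain
    inside the image of every strictly larger member.\<close>
  have *: "Q \<subseteq> W \<or> W \<subseteq> u ` Q"
    if Q: "Q \<in> tower" and ext: "\<forall>W\<in>tower. Q \<subset> W \<longrightarrow> Q \<subseteq> u ` W" and W: "W \<in> tower" for Q W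
    using W
  proof (induction rule: tower.induct)
    case (tower_image W)
    show ?case
    proof (cases "Q \<subset> W")
      case True
      with ext tower_image.hyps show ?thesis by blast
    next
      case False
      with tower_image.IH consider "W = Q" | "W \<subseteq> u ` Q" by blast
      then show ?thesis using tower_image_subset[OF tower_image.hyps] by cases auto
    qed
  next
    case (tower_Inter \<A>)
    then show ?case by blast
  qed
  \<comment> \<open>Second induction, on \<open>Q\<close>: every member has the property
    \<open>ext\<close>.\<close>
  have "\<forall>W\<in>tower. Q \<subset> W \<longrightarrow> Q \<subseteq> u ` W"
    using assms(1)
  proof (induction rule: tower.induct)
    case (tower_image Q)
    then show ?case using * [of Q] by blast
  next
    case (tower_Inter \<A>)
    show ?case
    proof (intro ballI impI)
      fix W assume W: "W \<in> tower" "\<Inter>\<A> \<subset> W"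
      then obtain Q where Q: "Q \<in> \<A>" "\<not> W \<subseteq> Q" by blast
      with tower_Inter have QT: "Q \<in> tower" and ext: "\<forall>W\<in>tower. Q \<subset> W \<longrightarrow> Q \<subseteq> u ` W" by auto
      have "Q \<subseteq> W"
        using *[OF QT ext W(1)] tower_image_subset[OF QT] Q by blast
      then have "Q \<subseteq> u ` W" using ext W(1) Q by blast
      then show "\<Inter>\<A> \<subseteq> u ` W" using Q by blast
    qed
  qed
  with * assms show ?thesis by blast
qed

lemma tower_chain: "Q \<in> tower \<Longrightarrow> W \<in> tower \<Longrightarrow> Q \<subseteq> W \<or> W \<subseteq> Q"
  using tower_successor[of Q W] tower_image_subset[of Q] by blast

lemma tower_fixed_least:
  assumes "u ` Q = Q" "W \<in> tower"
  shows "Q \<subseteq> W"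
  using assms(2)
proof (induction rule: tower.induct)
  case (tower_image W)
  then show ?case using assms(1) image_mono[of Q W u] by simp
qed blast

section \<open>Vectors of maximal height in a coset\<close>

text \<open>\<open>x\<close> has maximal height in its coset \<open>x + S\<close>.\<close>

definition proper :: "'b set \<Rightarrow> 'b \<Rightarrow> bool" where
  "proper S x \<longleftrightarrow> (\<forall>W\<in>tower. \<forall>s\<in>S. x + s \<in> W \<longrightarrow> x \<in> W)"

text \<open>A member \<open>W\<close> that meets the coset but does not contain \<open>Q\<close>
  would lie in \<open>u\<close>
  Q\<open>by\<close>tower_successor\<open>. Either the coset avoids\<close>u \<open>Q\<close>, or
  \<open>Q\<close> is the bottom of the tower and lies in \<open>W\<close> after all.\<close>

lemma properI:
  assumes "Q \<in> tower" "x \<in> Q" "u ` Q = Q \<or> (\<forall>s\<in>S. x + s \<notin> u ` Q)"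
  shows "proper S x"
  unfolding proper_def
proof (intro ballI impI)
  fix W s assume W: "W \<in> tower" "s \<in> S" "x + s \<in> W"
  show "x \<in> W"
  proof (cases "Q \<subseteq> W")
    case False
    with W assms show ?thesis using tower_fixed_least[of Q W] tower_successor[of Q W] by blast
  qed (use assms in blast)
qed

section \<open>Pairs respecting heights, and their extension by one vector\<close>

text \<open>
  The finiteness condition replaces finite dimension of \<open>A + B\<close>: it is what the existence of vectors
  of maximal height and the termination argument need.
\<close>

definition good :: "'b set \<Rightarrow> 'b set \<Rightarrow> bool" where
  "good A B \<longleftrightarrow> subspace A \<and> subspace B \<and> A \<inter> B \<subseteq> {0} \<and> u ` A \<subseteq> B \<and> u ` B \<subseteq> A \<and>
     (\<forall>W\<in>tower. \<forall>a\<in>A. \<forall>b\<in>B. a + b \<in> W \<longrightarrow> a \<in> W) \<and>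
     finite ((\<lambda>W. W \<inter> (A + B)) ` tower)"

lemma goodD:
  assumes "good A B"
  shows "subspace A" "subspace B" "subspace (A + B)" "A \<inter> B \<subseteq> {0}"
    "a \<in> A \<Longrightarrow> u a \<in> B" "b \<in> B \<Longrightarrow> u b \<in> A"
    "finite ((\<lambda>W. W \<inter> (A + B)) ` tower)"
  using assms subspace_set_plus[of A B] unfolding good_def by auto

lemma good_components:
  assumes "good A B" "W \<in> tower" "a \<in> A" "b \<in> B" "a + b \<in> W"
  shows "a \<in> W" "b \<in> W"
proof -
  show a: "a \<in> W" using assms unfolding good_def by blast
  show "b \<in> W" using subspace_diff[OF tower_subspace[OF assms(2)] assms(5) a] by simp
qed

text \<open>The height condition is imposed on the first summand only; subtraction transfers it to
  the second, so each absorption lemma has a mirror image.\<close>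

lemma good_commute:
  assumes "good A B" shows "good B A"
proof -
  have "b \<in> W" if "W \<in> tower" "b \<in> B" "a \<in> A" "b + a \<in> W" for W a b
    using good_components(2)[OF assms that(1,3,2)] that(4) by (simp add: add.commute)
  then show ?thesis using assms unfolding good_def by (auto simp: add.commute[of B A])
qed

lemma good_0: "good {0} {0}"
proof -
  have "(\<lambda>W. W \<inter> ({0} + {0})) ` tower \<subseteq> {{0}}"
    using tower_subspace subspace_0 by (auto simp: set_plus_def)
  then have "finite ((\<lambda>W. W \<inter> ({0} + {0})) ` tower)"
    by (rule finite_subset) simp
  then show ?thesis unfolding good_def by (auto simp: u_0)
qed

text \<open>An element of \<open>W\<close> with nonzero coefficient at \<open>x\<close> could be
  divided by it, giving an element of \<open>x + S\<close> in \<open>W\<close>.\<close>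

lemma inter_plus_line:
  assumes "subspace W" "subspace S" "\<forall>s\<in>S. x + s \<notin> W"
  shows "W \<inter> (S + line x) = W \<inter> S"
proof -
  have "y \<in> S" if y: "y \<in> W" "y \<in> S + line x" for y
  proof -
    obtain s c where s: "s \<in> S" "y = s + scale c x" using y(2) by (rule set_plus_lineE)
    have "c = 0"
    proof (rule ccontr)
      assume c: "c \<noteq> 0"
      then have "scale (inverse c) y = x + scale (inverse c) s"
        by (simp add: s scale_right_distrib add.commute)
      then show False using assms(3) subspace_scale[OF assms(1) y(1), of "inverse c"]
          subspace_scale[OF assms(2) s(1), of "inverse c"] by metis
    qed
    then show ?thesis using s by simp
  qed
  then show ?thesis using set_plus_left[OF subspace_line] by blast
qed

text \<open>If a sum involving \<open>x\<close> lies in \<open>W\<close>, properness puts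
  \<open>x\<close> itself into \<open>W\<close>. Subtracting it leaves a sum over the old pair,
  whose height condition applies.\<close>

lemma extend_proper:
  assumes g: "good A B" and ux: "u x \<in> A" and x: "x \<notin> A + B" and pr: "proper (A + B) x"
  shows "good A (B + line x)"
proof -
  note gd = goodD[OF g]
  let ?S = "A + B"
  have cancel: "x \<in> W"
    if W: "W \<in> tower" and s: "s \<in> ?S" "s + scale c x \<in> W" and c: "c \<noteq> 0" for W s c
  proof -
    have "scale (inverse c) (s + scale c x) = x + scale (inverse c) s"
      using c by (simp add: scale_right_distrib add.commute)
    then have "x + scale (inverse c) s \<in> W"
      using subspace_scale[OF tower_subspace[OF W] s(2)] by metis
    then show ?thesis using pr W subspace_scale[OF gd(3) s(1)] unfolding proper_def by blast
  qed
  have "a = 0" if a: "a \<in> A" "a \<in> B + line x" for a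
  proof -
    obtain b c where b: "b \<in> B" "a = b + scale c x" using a(2) by (rule set_plus_lineE)
    have "scale c x = a + (- b)" using b by simp
    also have "\<dots> \<in> ?S" using a b gd(2) by (intro set_plus_intro) (auto intro: subspace_neg)
    finally have "c = 0" using scale_mem_cancel[OF gd(3)] x by blast
    then show ?thesis using a b gd(4) by auto
  qed
  moreover have "u ` (B + line x) \<subseteq> A"
  proof
    fix y assume "y \<in> u ` (B + line x)"
    then obtain b c where "b \<in> B" "y = u (b + scale c x)" by (auto elim: set_plus_lineE)
    then show "y \<in> A" using gd(6) ux subspace_add[OF gd(1)] subspace_scale[OF gd(1)]
      by (simp add: u_add u_scale)
  qed
  moreover have "a \<in> W" if W: "W \<in> tower" and a: "a \<in> A" "b' \<in> B + line x" "a + b' \<in> W" for W a b'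
  proof -
    obtain b c where b: "b \<in> B" "b' = b + scale c x" using a(2) by (rule set_plus_lineE)
    have sum: "(a + b) + scale c x \<in> W" using a b by (simp add: add.assoc)
    have "scale c x \<in> W"
    proof (cases "c = 0")
      case True then show ?thesis using subspace_0[OF tower_subspace[OF W]] by simp
    next
      case False
      then show ?thesis
        using cancel[OF W _ sum] a b subspace_scale[OF tower_subspace[OF W]] by auto
    qed
    from subspace_diff[OF tower_subspace[OF W] sum this] have "a + b \<in> W" by simp
    then show ?thesis using good_components(1)[OF g W] a b by blast
  qed
  moreover have "finite ((\<lambda>W. W \<inter> (A + (B + line x))) ` tower)"
  proof (rule finite_subset)
    let ?F = "(\<lambda>W. W \<inter> ?S) ` tower"
    \<comment> \<open>Each old trace \<open>M\<close> gives rise to at most two new ones: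
      \<open>M\<close> if \<open>x\<close> is not in the tower member, \<open>M + line x\<close> if
      it is.\<close>
    show "finite (?F \<union> (\<lambda>M. M + line x) ` ?F)" using gd(7) by blast
    show "(\<lambda>W. W \<inter> (A + (B + line x))) ` tower \<subseteq> ?F \<union> (\<lambda>M. M + line x) ` ?F"
    proof
      fix M assume "M \<in> (\<lambda>W. W \<inter> (A + (B + line x))) ` tower"
      then obtain W where W: "W \<in> tower" and M: "M = W \<inter> (?S + line x)"
        by (auto simp: add.assoc)
      note sW = tower_subspace[OF W]
      show "M \<in> ?F \<union> (\<lambda>M. M + line x) ` ?F"
      proof (cases "x \<in> W")
        case False
        then have "\<forall>s\<in>?S. x + s \<notin> W" using pr W unfolding proper_def by blast
        then have "M = W \<inter> ?S" using inter_plus_line[OF sW gd(3)] M by simp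
        then show ?thesis using W by blast
      next
        case True
        have "M = (W \<inter> ?S) + line x"
        proof (intro equalityI subsetI)
          fix y assume "y \<in> M"
          then obtain s c where s: "y \<in> W" "s \<in> ?S" "y = s + scale c x"
            using M by (auto elim: set_plus_lineE)
          have "s \<in> W"
            using subspace_diff[OF sW s(1) subspace_scale[OF sW True, of c]] s by simp
          then show "y \<in> (W \<inter> ?S) + line x" using s by (auto simp: line_def)
        next
          fix y assume "y \<in> (W \<inter> ?S) + line x"
          then obtain s c where s: "s \<in> W \<inter> ?S" "y = s + scale c x" by (rule set_plus_lineE)
          then show "y \<in> M" unfolding M line_def
            using subspace_add[OF sW _ subspace_scale[OF sW True, of c]] by auto
        qed
        then show ?thesis using W by blast
      qed
    qed
  qed
  moreover have "u ` A \<subseteq> B + line x"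
    using gd(5) set_plus_left[OF subspace_line] by blast
  ultimately show ?thesis
    unfolding good_def using gd(1) subspace_set_plus[OF gd(2) subspace_line]
    by (intro conjI ballI impI subsetI) auto
qed

definition extends :: "'b set \<Rightarrow> 'b set \<Rightarrow> 'b set \<Rightarrow> 'b set \<Rightarrow> bool" where
  "extends A B A' B' \<longleftrightarrow> good A' B' \<and> A \<subseteq> A' \<and> B \<subseteq> B'"

lemma extends_trans: "extends A B A' B' \<Longrightarrow> extends A' B' A'' B'' \<Longrightarrow> extends A B A'' B''"
  unfolding extends_def by auto

lemma extends_commute: "extends A B A' B' \<Longrightarrow> extends B A B' A'"
  unfolding extends_def using good_commute by blast

lemma extends_plus: "extends A B A' B' \<Longrightarrow> A + B \<subseteq> A' + B'"
  unfolding extends_def using set_plus_mono2[of A A' B B'] by simp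

lemma absorb_proper:
  assumes g: "good A B" and ux: "u x \<in> A" and x: "x \<in> A + B \<or> proper (A + B) x"
  shows "\<exists>A' B'. extends A B A' B' \<and> x \<in> A' + B'"
proof (cases "x \<in> A + B")
  case True
  then show ?thesis using g unfolding extends_def by blast
next
  case False
  then have "good A (B + line x)" using assms extend_proper by blast
  moreover have "x \<in> A + (B + line x)"
    using goodD[OF g] self_in_line by (blast intro: set_plus_right)
  ultimately show ?thesis
    unfolding extends_def using set_plus_left[OF subspace_line] by blast
qed

lemma absorb_proper':
  assumes "good A B" "u x \<in> B" "x \<in> A + B \<or> proper (A + B) x"
  shows "\<exists>A' B'. extends A B A' B' \<and> x \<in> A' + B'"
proof -
  obtain B' A' where "extends B A B' A'" "x \<in> B' + A'"
    using absorb_proper[OF good_commute[OF assms(1)] assms(2)] assms(3)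
    by (auto simp: add.commute[of B A])
  then show ?thesis using extends_commute[of B A B' A'] by (auto simp: add.commute[of B' A'])
qed

section \<open>Maximal heights and the counting measure\<close>

text \<open>Among the members meeting the coset of \<open>x\<close>, finiteness provides one with
  minimal trace on \<open>A + B\<close>. Any \<open>s\<close> realizing it is a best approximation
  of \<open>x\<close>.\<close>

lemma level_exists:
  assumes g: "good A B"
  obtains Q s where "Q \<in> tower" "s \<in> A + B" "x - s \<in> Q"
    "\<And>W t. W \<in> tower \<Longrightarrow> t \<in> A + B \<Longrightarrow> x - t \<in> W \<Longrightarrow> Q \<subseteq> W"
proof -
  let ?S = "A + B"
  note gd = goodD[OF g]
  define \<W> where "\<W> = {W \<in> tower. \<exists>s\<in>?S. x - s \<in> W}"
  have "UNIV \<in> \<W>" unfolding \<W>_def using tower_UNIV subspace_0[OF gd(3)] by blast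
  moreover have "finite ((\<lambda>W. W \<inter> ?S) ` \<W>)"
    using gd(7) by (rule rev_finite_subset) (auto simp: \<W>_def)
  ultimately have "\<exists>M\<in>(\<lambda>W. W \<inter> ?S) ` \<W>. \<forall>M'\<in>(\<lambda>W. W \<inter> ?S) ` \<W>. M' \<subseteq> M \<longrightarrow> M = M'"
    by (intro finite_has_minimal) auto
  then obtain M where "M \<in> (\<lambda>W. W \<inter> ?S) ` \<W>"
    and minM: "\<And>M'. M' \<in> (\<lambda>W. W \<inter> ?S) ` \<W> \<Longrightarrow> M' \<subseteq> M \<Longrightarrow> M = M'"
    by (elim bexE) (metis (no_types, lifting))
  then obtain W0 where W0: "W0 \<in> \<W>" "M = W0 \<inter> ?S" by blast
  then obtain s where s: "s \<in> ?S" "x - s \<in> W0" and W0t: "W0 \<in> tower" unfolding \<W>_def by blast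
  define Q where "Q = \<Inter>{W \<in> tower. x - s \<in> W}"
  have "Q \<in> tower" unfolding Q_def by (rule tower_Inter) blast
  moreover have "x - s \<in> Q" unfolding Q_def by blast
  moreover have "Q \<subseteq> W" if W: "W \<in> tower" and t: "t \<in> ?S" "x - t \<in> W" for W t
  proof -
    have "x - s \<in> W"
    proof (cases "W0 \<subseteq> W")
      case False
      then have sub: "W \<subseteq> W0" using tower_chain W W0t by blast
      \<comment> \<open>By minimality a smaller member meeting the coset has the same trace, so
        \<open>s - t\<close> cannot leave \<open>W\<close>.\<close>
      then have eq: "W0 \<inter> ?S = W \<inter> ?S"
        using minM[of "W \<inter> ?S"] W0(2) W t unfolding \<W>_def by blast
      have "s - t \<in> W0"
        using subspace_diff[OF tower_subspace[OF W0t], of "x - t" "x - s"] sub t s by auto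
      then have "s - t \<in> W" using eq subspace_diff[OF gd(3) s(1) t(1)] by blast
      then show ?thesis using subspace_diff[OF tower_subspace[OF W] t(2)] by fastforce
    qed (use s in blast)
    then show ?thesis unfolding Q_def using W by blast
  qed
  ultimately show ?thesis using that s by blast
qed

text \<open>A numerical substitute for the ordinal position of \<open>W\<close>, as far as
  \<open>S\<close> can detect it; it drives the termination of
  \<open>extend_homogeneous\<close>.\<close>

definition traces :: "'b set \<Rightarrow> 'b set \<Rightarrow> nat" where
  "traces S W = card ((\<lambda>W'. W' \<inter> S) ` {W' \<in> tower. W' \<subseteq> W})"

lemma traces_mono:
  assumes "finite ((\<lambda>W. W \<inter> S) ` tower)" "Q \<subseteq> W"
  shows "traces S Q \<le> traces S W"
  unfolding traces_def
proof (rule card_mono)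
  show "finite ((\<lambda>W'. W' \<inter> S) ` {W' \<in> tower. W' \<subseteq> W})"
    using assms(1) by (rule rev_finite_subset) auto
qed (use assms(2) in blast)

text \<open>The trace of \<open>W\<close> itself is lost: every trace counted for \<open>Q\<close>
  lies in \<open>Q \<inter> S\<close>, which is strictly smaller.\<close>

lemma traces_strict_mono:
  assumes fin: "finite ((\<lambda>W. W \<inter> S) ` tower)" and "W \<in> tower" "Q \<subseteq> W" "Q \<inter> S \<noteq> W \<inter> S"
  shows "traces S Q < traces S W"
  unfolding traces_def
proof (rule psubset_card_mono)
  show "finite ((\<lambda>W'. W' \<inter> S) ` {W' \<in> tower. W' \<subseteq> W})"
    using fin by (rule rev_finite_subset) auto
  have "W \<inter> S \<notin> (\<lambda>W'. W' \<inter> S) ` {W' \<in> tower. W' \<subseteq> Q}" using assms(3,4) by blast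
  moreover have "W \<inter> S \<in> (\<lambda>W'. W' \<inter> S) ` {W' \<in> tower. W' \<subseteq> W}" using assms(2) by blast
  ultimately show "(\<lambda>W'. W' \<inter> S) ` {W' \<in> tower. W' \<subseteq> Q} \<subset> (\<lambda>W'. W' \<inter> S) ` {W' \<in> tower. W' \<subseteq> W}"
    using assms(3) by (intro psubsetI image_mono) (blast, metis)
qed

lemma traces_plus_line:
  assumes "subspace S" "\<forall>s\<in>S. x + s \<notin> Q" "W \<subseteq> Q"
  shows "traces (S + line x) W = traces S W"
proof -
  have "W' \<inter> (S + line x) = W' \<inter> S" if "W' \<in> tower" "W' \<subseteq> W" for W'
    using inter_plus_line[OF tower_subspace[OF that(1)] assms(1)] assms(2,3) that(2) by blast
  then have "(\<lambda>W'. W' \<inter> (S + line x)) ` {W' \<in> tower. W' \<subseteq> W}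
      = (\<lambda>W'. W' \<inter> S) ` {W' \<in> tower. W' \<subseteq> W}"
    by (intro image_cong) auto
  then show ?thesis unfolding traces_def by simp
qed

section \<open>Absorbing homogeneous vectors\<close>

text \<open>
  Let \<open>Q\<close> be the maximal height in the coset of \<open>x\<close>. Vectors of height exactly \<open>Q\<close> modulo \<open>A + B\<close> do
  not change the traces of the tower members below \<open>u Q\<close>. Absorbing one of them either absorbs \<open>x\<close>,
  or replaces it by a vector lying in \<open>u Q\<close> itself, or moves the coset of \<open>x\<close> into \<open>u Q\<close> while
  \<open>u Q \<inter> (A + B)\<close> strictly exceeds its trace on \<open>u (u Q)\<close>. The summand for \<open>x \<notin> W\<close> in the induction
  measure pays for the second outcome.
\<close>

lemma extend_homogeneous:
  assumes "good A B" "u x \<in> A" "W \<in> tower" "r \<in> A + B" "x - r \<in> W"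
  shows "\<exists>A' B'. extends A B A' B' \<and> x \<in> A' + B'"
  using assms
proof (induction "traces (A + B) W + traces (A + B) (u ` W) + (if x \<in> W then 0 else 1)"
    arbitrary: A B x W r rule: less_induct)
  case less
  note g = less.prems(1) and ux = less.prems(2) and W = less.prems(3)
  let ?S = "A + B"
  note gd = goodD[OF g]
  obtain Q s where Q: "Q \<in> tower" and s: "s \<in> ?S" "x - s \<in> Q"
    and least: "\<And>W t. W \<in> tower \<Longrightarrow> t \<in> ?S \<Longrightarrow> x - t \<in> W \<Longrightarrow> Q \<subseteq> W"
    using level_exists[OF g, of x] by blast
  let ?Q' = "u ` Q"
  have Q': "?Q' \<in> tower" by (rule tower_image[OF Q])
  have Q'Q: "?Q' \<subseteq> Q" by (rule tower_image_subset[OF Q])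
  have QW: "Q \<subseteq> W" by (rule least[OF W less.prems(4,5)])
  note sQ = tower_subspace[OF Q] and sQ' = tower_subspace[OF Q']
  obtain s0 s1 where s01: "s = s0 + s1" "s0 \<in> A" "s1 \<in> B" using s(1) by (rule set_plus_elim)
  define x1 where "x1 = x - s1"
  have x1Q: "x1 - s0 \<in> Q" using s(2) by (simp add: x1_def s01 algebra_simps)
  have ux1: "u x1 \<in> A"
    unfolding x1_def u_diff using subspace_diff[OF gd(1) ux gd(6)] s01 by blast
  have us0: "u (- s0) \<in> B" using gd(5) s01 subspace_neg[OF gd(2)] by (simp add: u_neg)
  have "u x1 + u (- s0) \<in> ?Q'" using x1Q by (simp flip: u_add)
  note ux1Q' = good_components[OF g Q' ux1 us0 this]
  show ?case
  proof (cases "?Q' = Q")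
    case True
    have pr: "proper T y" if "y \<in> Q" for T y
      using properI[OF Q that] True by blast
    \<comment> \<open>At the bottom of the tower every vector is proper. So \<open>x - s\<close> is
      written as \<open>z\<close> plus a rest in \<open>Q\<close>, with images in \<open>A\<close>
      and \<open>B\<close>, and both are absorbed directly.\<close>
    obtain z where z: "z \<in> Q" "u z = u x1" using ux1Q'(1) by force
    obtain A1 B1 where e1: "extends A B A1 B1" "z \<in> A1 + B1"
      using absorb_proper[OF g, of z] pr z ux1 by auto
    have l: "x1 - s0 - z \<in> Q" using subspace_diff[OF sQ x1Q z(1)] .
    have "u (x1 - s0 - z) \<in> B1"
      using us0 z e1(1) by (auto simp: u_diff u_neg extends_def)
    then obtain A2 B2 where e2: "extends A1 B1 A2 B2" "x1 - s0 - z \<in> A2 + B2"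
      using absorb_proper'[of A1 B1 "x1 - s0 - z"] pr[OF l] e1(1) unfolding extends_def by auto
    have e: "extends A B A2 B2" using e1(1) e2(1) by (rule extends_trans)
    then have "subspace (A2 + B2)" using goodD(3) unfolding extends_def by blast
    moreover have "s \<in> A2 + B2" "z \<in> A2 + B2"
      using s(1) e1(2) extends_plus[OF e] extends_plus[OF e2(1)] by blast+
    moreover have "x = (x1 - s0 - z) + z + s" by (simp add: x1_def s01)
    ultimately have "x \<in> A2 + B2" using e2(2) subspace_add by metis
    with e show ?thesis by blast
  next
    case False
    have notQ': False if "t \<in> ?S" "x - t \<in> ?Q'" for t
      using least[OF Q' that] False Q'Q by blast
    show ?thesis
    \<comment> \<open>With equal traces, \<open>s\<close> lies in \<open>Q\<close>, hence so does
      \<open>x\<close>: it already has the maximal height of its coset. Otherwise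
      \<open>x \<notin> W\<close> or the number of traces drops from \<open>W\<close> to
      \<open>Q\<close>.\<close>
    proof (cases "x \<in> W \<and> Q \<inter> ?S = W \<inter> ?S")
      case True
      then have "s \<in> W" using subspace_diff[OF tower_subspace[OF W], of x "x - s"] s(2) QW by auto
      then have "x \<in> Q" using True s subspace_add[OF sQ s(2), of s] by auto
      moreover have "x + t \<notin> ?Q'" if "t \<in> ?S" for t
        using notQ'[of "- t"] that subspace_neg[OF gd(3)] by auto
      ultimately have "proper ?S x" using properI[OF Q] by blast
      then show ?thesis using absorb_proper[OF g ux] by blast
    next
      case stuck: False
      have drop: "traces ?S Q < traces ?S W" if "x \<in> W"
        using traces_strict_mono[OF gd(7) W QW] stuck that by blast
      have le: "traces ?S Q \<le> traces ?S W" "traces ?S ?Q' \<le> traces ?S Q"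
        "traces ?S ?Q' \<le> traces ?S (u ` W)" "traces ?S (u ` ?Q') \<le> traces ?S ?Q'"
        using traces_mono[OF gd(7)] QW Q'Q tower_image_subset[OF Q'] by (auto simp: image_mono)
      show ?thesis
      proof (cases "\<exists>t\<in>B \<inter> Q. u (x1 - t) \<in> u ` ?Q'")
        case True
        then obtain t where t: "t \<in> B" "t \<in> Q" "u (x1 - t) \<in> u ` ?Q'" by blast
        then obtain z where z: "z \<in> ?Q'" "u z = u (x1 - t)" by force
        \<comment> \<open>Modulo \<open>A + B\<close>, \<open>x\<close> is \<open>l + z\<close>.
          Here \<open>l\<close> has height exactly \<open>Q\<close> and image in \<open>B\<close>,
          so it enlarges \<open>A\<close>; the recursion then treats \<open>z\<close>, which lies in
          \<open>?Q'\<close> and has its image in \<open>A\<close>.\<close>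
        define l where "l = x1 - t - z - s0"
        have "x1 - s0 - t - z \<in> Q"
          using subspace_diff[OF sQ subspace_diff[OF sQ x1Q t(2)], of z] z(1) Q'Q by blast
        then have lQ: "l \<in> Q" by (simp add: l_def algebra_simps)
        have lout: "\<forall>p\<in>?S. l + p \<notin> ?Q'"
        proof (intro ballI notI)
          fix p assume p: "p \<in> ?S" "l + p \<in> ?Q'"
          have "t \<in> ?S" using t(1) by (rule set_plus_right[OF gd(1)])
          then have "s + t - p \<in> ?S" using s(1) p(1) gd(3) by (simp add: subspace_add subspace_diff)
          moreover have "x - (s + t - p) = l + p + z" by (simp add: l_def x1_def s01)
          ultimately show False using notQ' subspace_add[OF sQ' p(2) z(1)] by metis
        qed
        have "l \<notin> ?S"
          using lout[rule_format, of "- l"] subspace_neg[OF gd(3), of l] subspace_0[OF sQ'] by auto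
        moreover have "u l \<in> B" using us0 z by (simp add: l_def u_diff u_neg)
        moreover have "proper ?S l" using properI[OF Q lQ] lout by blast
        ultimately have g': "good (A + line l) B"
          using extend_proper[OF good_commute[OF g], of l] good_commute by (simp add: add.commute[of B A])
        have S': "A + line l + B = ?S + line l" by (simp add: add.assoc add.commute[of B])
        have e1: "extends A B (A + line l) B"
          unfolding extends_def using g' set_plus_left[OF subspace_line] by blast
        have "traces (A + line l + B) ?Q' + traces (A + line l + B) (u ` ?Q') + (if z \<in> ?Q' then 0 else 1)
            = traces ?S ?Q' + traces ?S (u ` ?Q')"
          unfolding S' using traces_plus_line[OF gd(3) lout] tower_image_subset[OF Q'] z by simp
        also have "\<dots> < traces ?S W + traces ?S (u ` W) + (if x \<in> W then 0 else 1)"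
          using le drop by (cases "x \<in> W") auto
        finally have lt: "traces (A + line l + B) ?Q' + traces (A + line l + B) (u ` ?Q')
          + (if z \<in> ?Q' then 0 else 1) < \<dots>" .
        have "u z \<in> A"
          using z ux1 gd(6)[OF t(1)] subspace_diff[OF gd(1)] by (simp add: u_diff)
        then have "u z \<in> A + line l" using e1 unfolding extends_def by blast
        then obtain A2 B2 where e2: "extends (A + line l) B A2 B2" "z \<in> A2 + B2"
          using less.hyps[OF lt g' _ Q', of 0] z subspace_0[OF goodD(3)[OF g']] by auto
        have e: "extends A B A2 B2" using e1 e2(1) by (rule extends_trans)
        then have sub: "subspace (A2 + B2)" using goodD(3) unfolding extends_def by blast
        have "l \<in> A2 + B2"
          using extends_plus[OF e2(1)] set_plus_right[OF gd(3) self_in_line, of l] unfolding S' by blast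
        moreover have "s \<in> A2 + B2" "t \<in> A2 + B2"
          using s(1) set_plus_right[OF gd(1) t(1)] extends_plus[OF e] by blast+
        moreover have "x = l + z + t + s" by (simp add: l_def x1_def s01)
        ultimately have "x \<in> A2 + B2" using e2(2) sub by (simp add: subspace_add)
        with e show ?thesis by blast
      next
        case new: False
        obtain z where z: "z \<in> Q" "u z = u x1" using ux1Q'(1) by force
        \<comment> \<open>If \<open>z + p\<close> were in \<open>?Q'\<close>, the \<open>A\<close>
          component of \<open>u (z + p)\<close> would be \<open>u (x1 + p1)\<close>, and
          \<open>t = - p1\<close> would contradict \<open>new\<close>.\<close>
        have zout: "\<forall>p\<in>?S. z + p \<notin> ?Q'"
        proof (intro ballI notI)
          fix p assume p: "p \<in> ?S" "z + p \<in> ?Q'"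
          then obtain p0 p1 where p01: "p = p0 + p1" "p0 \<in> A" "p1 \<in> B" by (auto elim: set_plus_elim)
          have "p \<in> Q" using subspace_diff[OF sQ, of "z + p" z] p Q'Q z by auto
          then have p1: "p1 \<in> Q" using good_components(2)[OF g Q] p01 by blast
          have "u (x1 + p1) + u p0 \<in> u ` ?Q'"
            using imageI[OF p(2), of u] z p01 by (simp add: u_add algebra_simps)
          moreover have "u (x1 + p1) \<in> A"
            using subspace_add[OF gd(1) ux1 gd(6)[OF p01(3)]] by (simp add: u_add)
          ultimately have "u (x1 - (- p1)) \<in> u ` ?Q'"
            using good_components(1)[OF g tower_image[OF Q'], of "u (x1 + p1)" "u p0"] gd(5) p01 by simp
          then show False using new p01 p1 subspace_neg[OF gd(2)] subspace_neg[OF sQ] by blast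
        qed
        have "z \<notin> ?S"
          using zout[rule_format, of "- z"] subspace_neg[OF gd(3), of z] subspace_0[OF sQ'] by auto
        moreover have "u z \<in> A" using z ux1 by simp
        moreover have "proper ?S z" using properI[OF Q z(1)] zout by blast
        ultimately have g': "good A (B + line z)" using extend_proper[OF g] by blast
        let ?S' = "A + (B + line z)"
        have S': "?S' = ?S + line z" by (simp add: add.assoc)
        note gd' = goodD[OF g']
        have e1: "extends A B A (B + line z)"
          unfolding extends_def using g' set_plus_left[OF subspace_line] by blast
        have zS': "z \<in> ?S'" unfolding S' by (rule set_plus_right[OF gd(3) self_in_line])
        have sS': "s \<in> ?S'" using s(1) extends_plus[OF e1] by blast
        define l where "l = x1 - z - s0"
        have x: "x = l + z + s" by (simp add: l_def x1_def s01)
        have "x1 - s0 - z \<in> Q" by (rule subspace_diff[OF sQ x1Q z(1)])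
        then have lQ: "l \<in> Q" by (simp add: l_def algebra_simps)
        have ul: "u l \<in> B + line z"
          using us0 z e1 by (auto simp: l_def u_diff u_neg extends_def)
        show ?thesis
        proof (cases "\<exists>p\<in>?S'. l + p \<in> ?Q'")
          case False
          then have "proper ?S' l" using properI[OF Q lQ] by blast
          then obtain A2 B2 where e2: "extends A (B + line z) A2 B2" "l \<in> A2 + B2"
            using absorb_proper'[OF g' ul] by blast
          have e: "extends A B A2 B2" using e1 e2(1) by (rule extends_trans)
          then have sub: "subspace (A2 + B2)" using goodD(3) unfolding extends_def by blast
          have "z \<in> A2 + B2" "s \<in> A2 + B2" using zS' sS' extends_plus[OF e2(1)] by blast+
          then have "x \<in> A2 + B2" using x e2(2) sub by (simp add: subspace_add)
          with e show ?thesis by blast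
        next
          case True
          then obtain p where p: "p \<in> ?S'" "l + p \<in> ?Q'" by blast
          have r: "z + s - p \<in> ?S'" "x - (z + s - p) \<in> ?Q'"
            using p zS' sS' gd'(3) by (auto simp: x subspace_add subspace_diff)
          \<comment> \<open>The instance \<open>t = 0\<close> of \<open>new\<close> shows that
            \<open>u x1\<close> is in the trace of \<open>?Q'\<close> but not of its image; this
            strict drop offsets the summand 1 when recursing on \<open>x\<close> with
            \<open>?Q'\<close>.\<close>
          have "u (x1 - 0) \<notin> u ` ?Q'" using new subspace_0[OF gd(2)] subspace_0[OF sQ] by blast
          then have "u x1 \<notin> u ` ?Q'" by simp
          moreover have "u x1 \<in> ?S" using ux1 by (rule set_plus_left[OF gd(2)])
          ultimately have "u ` ?Q' \<inter> ?S \<noteq> ?Q' \<inter> ?S" using ux1Q'(1) by blast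
          then have lt': "traces ?S (u ` ?Q') < traces ?S ?Q'"
            by (rule traces_strict_mono[OF gd(7) Q' tower_image_subset[OF Q']])
          have "traces ?S' ?Q' + traces ?S' (u ` ?Q') + (if x \<in> ?Q' then 0 else 1)
            \<le> traces ?S ?Q' + traces ?S (u ` ?Q') + 1"
            unfolding S' using traces_plus_line[OF gd(3) zout] tower_image_subset[OF Q'] by simp
          also have "\<dots> < traces ?S W + traces ?S (u ` W) + (if x \<in> W then 0 else 1)"
            using le lt' drop by (cases "x \<in> W") auto
          finally have lt: "traces ?S' ?Q' + traces ?S' (u ` ?Q') + (if x \<in> ?Q' then 0 else 1) < \<dots>" .
          obtain A2 B2 where e2: "extends A (B + line z) A2 B2" "x \<in> A2 + B2"
            using less.hyps[OF lt g' ux Q' r] by blast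
          then show ?thesis using extends_trans[OF e1] by blast
        qed
      qed
    qed
  qed
qed

lemma extend_homogeneous_left:
  assumes "good A B" "u x \<in> A"
  shows "\<exists>A' B'. extends A B A' B' \<and> x \<in> A' + B'"
  using extend_homogeneous[OF assms tower_UNIV subspace_0] goodD(3)[OF assms(1)] by blast

lemma extend_homogeneous_right:
  assumes "good A B" "u x \<in> B"
  shows "\<exists>A' B'. extends A B A' B' \<and> x \<in> A' + B'"
proof -
  obtain B' A' where "extends B A B' A'" "x \<in> B' + A'"
    using extend_homogeneous_left[OF good_commute[OF assms(1)] assms(2)] by blast
  then show ?thesis using extends_commute[of B A B' A'] by (auto simp: add.commute[of B' A'])
qed

section \<open>Absorbing nilpotent vectors and taking the union of the chain\<close>

text \<open>Once \<open>u x\<close> is absorbed, its two components get preimages \<open>z\<close>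
  and \<open>w\<close>, which are homogeneous. The rest \<open>x - z - w\<close> lies in the kernel
  and is homogeneous because 0 lies in both summands.\<close>

lemma extend_nilpotent:
  assumes "good A B" "(u ^^ n) x = 0"
  shows "\<exists>A' B'. extends A B A' B' \<and> x \<in> A' + B'"
  using assms(2)
proof (induction n arbitrary: x)
  case 0
  then show ?case
    using assms(1) subspace_0[OF goodD(3)[OF assms(1)]] unfolding extends_def by auto
next
  case (Suc n)
  then have "(u ^^ n) (u x) = 0" by (simp add: funpow_swap1)
  then obtain A1 B1 where e1: "extends A B A1 B1" and "u x \<in> A1 + B1" using Suc.IH by blast
  then obtain y0 y1 where y: "u x = y0 + y1" "y0 \<in> A1" "y1 \<in> B1" by (auto elim: set_plus_elim)
  have g1: "good A1 B1" using e1 unfolding extends_def by blast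
  \<comment> \<open>The height condition for the tower member \<open>range u\<close> makes each
    component an image.\<close>
  have "y0 + y1 \<in> range u" by (simp flip: y(1))
  from good_components[OF g1 tower_image[OF tower_UNIV] y(2,3) this]
  obtain z w where zw: "u z = y0" "u w = y1" by force
  obtain A2 B2 where e2: "extends A1 B1 A2 B2" "z \<in> A2 + B2"
    using extend_homogeneous_left[OF g1, of z] zw y by blast
  then obtain A3 B3 where e3: "extends A2 B2 A3 B3" "w \<in> A3 + B3"
    using extend_homogeneous_right[of A2 B2 w] zw y unfolding extends_def by blast
  have g3: "good A3 B3" using e3 unfolding extends_def by blast
  have "u (x - z - w) \<in> A3"
    using y zw subspace_0[OF goodD(1)[OF g3]] by (simp add: u_diff)
  then obtain A4 B4 where e4: "extends A3 B3 A4 B4" "x - z - w \<in> A4 + B4"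
    using extend_homogeneous_left[OF g3] by blast
  have "subspace (A4 + B4)" using e4 goodD(3) unfolding extends_def by blast
  moreover have "z \<in> A4 + B4" "w \<in> A4 + B4"
    using e2(2) e3(2) extends_plus[OF e3(1)] extends_plus[OF e4(1)] by blast+
  ultimately have "x - z - w + z + w \<in> A4 + B4" using e4(2) by (intro subspace_add)
  moreover have "extends A B A4 B4" using e1 e2(1) e3(1) e4(1) by (blast intro: extends_trans)
  ultimately show ?case by auto
qed

lemma grading_exists:
  assumes "countable_dimension scale" "locally_nilpotent u"
  obtains A B where "subspace A" "subspace B" "A \<inter> B \<subseteq> {0}" "A + B = UNIV" "u ` A \<subseteq> B" "u ` B \<subseteq> A"
proof -
  obtain X where X: "countable X" "span X = UNIV"
    using assms(1) unfolding countable_dimension_def by blast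
  \<comment> \<open>Repetitions for finite \<open>X\<close> and the arbitrary values for empty
    \<open>X\<close> do no harm, since every vector can be absorbed.\<close>
  define e where "e = from_nat_into X"
  have Xe: "X \<subseteq> range e" unfolding e_def using X(1) by (rule subset_range_from_nat_into)
  have "\<exists>f. \<forall>n. good (fst (f n)) (snd (f n)) \<and>
      (extends (fst (f n)) (snd (f n)) (fst (f (Suc n))) (snd (f (Suc n))) \<and>
       e n \<in> fst (f (Suc n)) + snd (f (Suc n)))"
  proof (rule dependent_nat_choice)
    show "\<exists>p. good (fst p) (snd p)" using good_0 by (intro exI[of _ "({0}, {0})"]) simp
  next
    fix p :: "'b set \<times> 'b set" and n
    assume p: "good (fst p) (snd p)"
    obtain k where "(u ^^ k) (e n) = 0"
      using assms(2) unfolding locally_nilpotent_def by blast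
    then obtain A B where "extends (fst p) (snd p) A B" "e n \<in> A + B"
      using extend_nilpotent[OF p] by blast
    then show "\<exists>q. good (fst q) (snd q) \<and>
        (extends (fst p) (snd p) (fst q) (snd q) \<and> e n \<in> fst q + snd q)"
      by (intro exI[of _ "(A, B)"]) (simp add: extends_def)
  qed
  then obtain f where f: "\<And>n. good (fst (f n)) (snd (f n)) \<and>
      extends (fst (f n)) (snd (f n)) (fst (f (Suc n))) (snd (f (Suc n))) \<and>
      e n \<in> fst (f (Suc n)) + snd (f (Suc n))"
    by metis
  define F G where "F n = fst (f n)" and "G n = snd (f n)" for n
  have good: "good (F n) (G n)" and step: "F n \<subseteq> F (Suc n)" "G n \<subseteq> G (Suc n)"
    "e n \<in> F (Suc n) + G (Suc n)" for n
    using f[of n] by (simp_all add: F_def G_def extends_def)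
  have monoF: "F m \<subseteq> F n" and monoG: "G m \<subseteq> G n" if "m \<le> n" for m n
    using lift_Suc_mono_le[of F] lift_Suc_mono_le[of G] step that by blast+
  have subspace_UN: "subspace (\<Union>n. H n)"
    if sub: "\<And>n. subspace (H n)" and mono: "\<And>m n. m \<le> n \<Longrightarrow> H m \<subseteq> H n" for H :: "nat \<Rightarrow> 'b set"
    unfolding subspace_def
  proof (intro conjI ballI allI)
    show "0 \<in> (\<Union>n. H n)" using subspace_0[OF sub] by blast
    fix x assume "x \<in> (\<Union>n. H n)"
    then obtain m where m: "x \<in> H m" by blast
    show "scale c x \<in> (\<Union>n. H n)" for c using subspace_scale[OF sub m] by blast
    fix y assume "y \<in> (\<Union>n. H n)"
    then obtain n where n: "y \<in> H n" by blast
    have "x \<in> H (max m n)" "y \<in> H (max m n)"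
      using m n mono[of m "max m n"] mono[of n "max m n"] by auto
    then show "x + y \<in> (\<Union>n. H n)" using subspace_add[OF sub] by blast
  qed
  let ?A = "\<Union>n. F n" and ?B = "\<Union>n. G n"
  have A: "subspace ?A" and B: "subspace ?B"
    using subspace_UN[of F] subspace_UN[of G] goodD(1,2)[OF good] monoF monoG by blast+
  have "X \<subseteq> ?A + ?B"
  proof
    fix x assume "x \<in> X"
    then obtain n where "x = e n" using Xe by blast
    then have "x \<in> F (Suc n) + G (Suc n)" using step(3) by simp
    also have "\<dots> \<subseteq> ?A + ?B" by (intro set_plus_mono2) blast+
    finally show "x \<in> ?A + ?B" .
  qed
  then have sum: "?A + ?B = UNIV" using span_minimal[OF _ subspace_set_plus[OF A B]] X(2) by blast
  have disj: "?A \<inter> ?B \<subseteq> {0}"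
  proof
    fix x assume "x \<in> ?A \<inter> ?B"
    then obtain m n where "x \<in> F m" "x \<in> G n" by blast
    then have "x \<in> F (max m n) \<inter> G (max m n)"
      using monoF[of m "max m n"] monoG[of n "max m n"] by auto
    then show "x \<in> {0}" using goodD(4)[OF good] by blast
  qed
  have "u ` ?A \<subseteq> ?B" "u ` ?B \<subseteq> ?A" using goodD(5,6)[OF good] by blast+
  with disj sum show ?thesis by (rule that[OF A B])
qed

section \<open>From the grading to the square-zero summands\<close>

lemma sum_of_square_zero_of_grading:
  assumes A: "subspace A" and B: "subspace B" and disj: "A \<inter> B \<subseteq> {0}" and sum: "A + B = UNIV"
    and uA: "u ` A \<subseteq> B" and uB: "u ` B \<subseteq> A"
  shows "\<exists>a b. endomorphism scale a \<and> endomorphism scale b \<and>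
           square_zero a \<and> square_zero b \<and> u = (\<lambda>x. a x + b x)"
proof -
  have "\<exists>y. y \<in> A \<and> x - y \<in> B" for x
  proof -
    obtain y z where "x = y + z" "y \<in> A" "z \<in> B"
      using sum set_plus_elim[of x A B] by blast
    then show ?thesis by (intro exI[of _ y]) simp
  qed
  \<comment> \<open>\<open>p\<close> is the projection onto \<open>A\<close> along \<open>B\<close>;
    uniqueness of the decomposition yields its linearity.\<close>
  then obtain p where p: "\<And>x. p x \<in> A" "\<And>x. x - p x \<in> B" by metis
  have p_unique: "p x = y" if y: "y \<in> A" "x - y \<in> B" for x y
  proof -
    have "p x - y \<in> A" using p(1) y(1) A by (intro subspace_diff)
    moreover have "p x - y \<in> B" using subspace_diff[OF B y(2) p(2)[of x]] by simp
    ultimately show ?thesis using disj by auto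
  qed
  have p_add: "p (x + y) = p x + p y" for x y
    using subspace_add[OF A p(1) p(1)] subspace_add[OF B p(2)[of x] p(2)[of y]]
    by (intro p_unique) (simp_all add: algebra_simps)
  have p_scale: "p (scale c x) = scale c (p x)" for c x
    using subspace_scale[OF A p(1)] subspace_scale[OF B p(2)[of x]]
    by (intro p_unique) (simp_all add: scale_right_diff_distrib)
  have linear: "endomorphism scale h"
    if "\<And>x y. h (x + y) = h x + h y" "\<And>c x. h (scale c x) = scale c (h x)" for h
    using that vector_space_axioms module_axioms
    by (simp add: Vector_Spaces.linear_def module_hom_def module_hom_axioms_def)
  define a b where "a x = u (p x)" and "b x = u (x - p x)" for x
  have "endomorphism scale a" "endomorphism scale b"
    by (rule linear; simp add: a_def b_def p_add p_scale u_add u_diff u_scale scale_right_diff_distrib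
        algebra_simps)+
  \<comment> \<open>\<open>u\<close> carries \<open>A\<close> into \<open>B\<close>, where
    \<open>p\<close> vanishes; dually below, it carries \<open>B\<close> into \<open>A\<close>,
    which \<open>p\<close> fixes.\<close>
  moreover have "p (u (p x)) = 0" for x
    using uA p(1) subspace_0[OF A] by (intro p_unique) auto
  then have "square_zero a" by (simp add: square_zero_def fun_eq_iff a_def u_0)
  moreover have "p (u (x - p x)) = u (x - p x)" for x
    using uB p(2) subspace_0[OF B] by (intro p_unique) auto
  then have "square_zero b" by (simp add: square_zero_def fun_eq_iff b_def u_0)
  moreover have "u = (\<lambda>x. a x + b x)" by (simp add: fun_eq_iff a_def b_def flip: u_add)
  ultimately show ?thesis by blast
qed

end

theorem theorem1p6:
  fixes scale :: "'a::field \<Rightarrow> 'b::ab_group_add \<Rightarrow> 'b"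
    and u :: "'b \<Rightarrow> 'b"
  assumes "vector_space scale"
    and "countable_dimension scale"
    and "endomorphism scale u"
    and "locally_nilpotent u"
  shows "\<exists>a b. endomorphism scale a \<and> endomorphism scale b \<and>
           square_zero a \<and> square_zero b \<and> u = (\<lambda>x. a x + b x)"
proof -
  interpret endo scale u
    using assms(1,3) by (simp add: endo_def endo_axioms_def)
  obtain A B where "subspace A" "subspace B" "A \<inter> B \<subseteq> {0}" "A + B = UNIV"
    "u ` A \<subseteq> B" "u ` B \<subseteq> A"
    using grading_exists[OF assms(2,4)] by blast
  then show ?thesis by (rule sum_of_square_zero_of_grading)
qed

end
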